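(* Let $\Omega\subset\mathbb{R}^n$ be a convex domain, let $u:\Omega\to\mathbb{R}$ be a convex function, let $f\in C(\Omega)$ be non-negative, and let $\phi(\varepsilon)$, $\varepsilon>0$, be a positive function with $\lim_{\varepsilon\to0}\phi(\varepsilon)=\infty$ and $\lim_{\varepsilon\to0}\varepsilon\,\phi(\varepsilon)=0$. Let $\mathbb{O}$ be the set of all orthonormal bases $V=\{v_1,\dots,v_n\}$ of $\mathbb{R}^n$ and, for $\varepsilon>0$, let $$I_\varepsilon^n=\Big\{(\alpha_1,\dots,\alpha_n)\in\mathbb{R}^n:\ \prod_{j=1}^n\alpha_j=1\ \text{ and }\ 0<\alpha_j<\phi^2(\varepsilon)\ \text{for all } j\Big\}.$$ Then the asymptotic expansion $$u(x)=\inf_{V\in\mathbb{O}}\ \inf_{(\alpha_1,\dots,\alpha_n)\in I_\varepsilon^n}\left\{\frac1n\sum_{i=1}^n\left(\frac12u(x+\varepsilon\sqrt{\alpha_i}\,v_i)+\frac12u(x-\varepsilon\sqrt{\alpha_i}\,v_i)\right)\right\}-\frac{\varepsilon^2}{2}(f(x))^{1/n}+o(\varepsilon^2)\qquad\text{as }\varepsilon\to0$$ holds in the viscosity sense for $x\in\Omega$ if and only if $u$ is a viscosity solution of the Monge-Ampère equation $\det(D^2u(x))=f(x)$ in $\Omega$.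
   Context: A paraboloid is a polynomial $P:\mathbb{R}^n\to\mathbb{R}$ of degree at most two; it is convex iff $D^2P\ge0$. $P$ touches $u$ from above (resp. below) at $x\in\Omega$ if $P(x)=u(x)$ and $P\ge u$ (resp. $P\le u$) in a neighborhood of $x$. The expansion holds in the viscosity sense if for every $x\in\Omega$, whenever a convex paraboloid $P$ touches $u$ from above (respectively from below) at $x$, one has, as $\varepsilon\to0$, $$P(x)\le(\text{respectively }\ge)\ \inf_{V\in\mathbb{O}}\ \inf_{(\alpha_1,\dots,\alpha_n)\in I_\varepsilon^n}\left\{\frac1n\sum_{i=1}^n\left(\frac12P(x+\varepsilon\sqrt{\alpha_i}\,v_i)+\frac12P(x-\varepsilon\sqrt{\alpha_i}\,v_i)\right)\right\}-\frac{\varepsilon^2}{2}(f(x))^{1/n}+o(\varepsilon^2).$$ Here, for a constant $c$ and a real function $g$, "$c\le g(\varepsilon)+o(\varepsilon^2)$" means $\lim_{\varepsilon\to0}[c-g(\varepsilon)]^+/\varepsilon^2=0$ and "$c\ge g(\varepsilon)+o(\varepsilon^2)$" means $\lim_{\varepsilon\to0}[c-g(\varepsilon)]^-/\varepsilon^2=0$. A convex function $u$ is a viscosity solution of $\det D^2u=f$ in $\Omega$ if it is both a subsolution and a supersolution: for every $x_0\in\Omega$, every convex paraboloid $P$ touching $u$ from above at $x_0$ satisfies $\det D^2P(x_0)\ge f(x_0)$, and every convex paraboloid $P$ touching $u$ from below at $x_0$ satisfies $\det D^2P(x_0)\le f(x_0)$. *)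

theory Defs
  imports "HOL-Analysis.Analysis"
begin

text \<open>The matrix \<open>A\<close> need not be symmetric, so every polynomial of degree at most two has this form.\<close>

definition paraboloid :: "(real ^ 'n \<Rightarrow> real) \<Rightarrow> bool" where
  "paraboloid P \<longleftrightarrow>
     (\<exists>(A :: real ^ 'n ^ 'n) b c. \<forall>x. P x = x \<bullet> (A *v x) + b \<bullet> x + c)"

definition convex_paraboloid :: "(real ^ 'n \<Rightarrow> real) \<Rightarrow> bool" where
  "convex_paraboloid P \<longleftrightarrow> paraboloid P \<and> convex_on UNIV P"

definition hessian :: "(real ^ 'n \<Rightarrow> real) \<Rightarrow> real ^ 'n \<Rightarrow> real ^ 'n ^ 'n" where
  "hessian g x =
     (\<chi> i j. frechet_derivative (\<lambda>y. frechet_derivative g (at y) (axis j 1)) (at x) (axis i 1))"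

text \<open>Functions on \<open>\<Omega>\<close> are total functions of which only the values on \<open>\<Omega>\<close> matter;
  hence neighbourhoods are taken relative to \<open>\<Omega>\<close>.\<close>

definition touches_above ::
    "(real ^ 'n) set \<Rightarrow> (real ^ 'n \<Rightarrow> real) \<Rightarrow> (real ^ 'n \<Rightarrow> real) \<Rightarrow> real ^ 'n \<Rightarrow> bool" where
  "touches_above \<Omega> u P x \<longleftrightarrow> P x = u x \<and> (\<forall>\<^sub>F y in at x within \<Omega>. P y \<ge> u y)"

definition touches_below ::
    "(real ^ 'n) set \<Rightarrow> (real ^ 'n \<Rightarrow> real) \<Rightarrow> (real ^ 'n \<Rightarrow> real) \<Rightarrow> real ^ 'n \<Rightarrow> bool" where
  "touches_below \<Omega> u P x \<longleftrightarrow> P x = u x \<and> (\<forall>\<^sub>F y in at x within \<Omega>. P y \<le> u y)"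

text \<open>Orthonormal bases are enumerated by the index type. The enumeration is immaterial below,
  because the constraint on \<open>\<alpha>\<close> is invariant under permutations of the indices.\<close>

definition orthonormal_bases :: "('n \<Rightarrow> real ^ 'n) set" where
  "orthonormal_bases =
     {v. (\<forall>i j. v i \<bullet> v j = (if i = j then 1 else 0)) \<and> span (range v) = UNIV}"

definition I_set :: "(real \<Rightarrow> real) \<Rightarrow> real \<Rightarrow> (real ^ 'n) set" where
  "I_set \<phi> \<epsilon> = {\<alpha>. (\<Prod>j\<in>UNIV. \<alpha> $ j) = 1 \<and> (\<forall>j. 0 < \<alpha> $ j \<and> \<alpha> $ j < (\<phi> \<epsilon>)\<^sup>2)}"

text \<open>The infima are in the reals. For convex \<open>P\<close> all averages are at least \<open>P x\<close>, and
  \<open>I_set \<phi> \<epsilon>\<close> is nonempty once \<open>\<phi> \<epsilon> > 1\<close>, so they are genuine for small \<open>\<epsilon>\<close>.\<close>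

definition inf_mean :: "(real \<Rightarrow> real) \<Rightarrow> (real ^ 'n \<Rightarrow> real) \<Rightarrow> real ^ 'n \<Rightarrow> real \<Rightarrow> real" where
  "inf_mean \<phi> P x \<epsilon> =
     (INF v\<in>orthonormal_bases. INF \<alpha>\<in>I_set \<phi> \<epsilon>.
        1 / real CARD('n) *
        (\<Sum>i\<in>UNIV. 1 / 2 * P (x + (\<epsilon> * sqrt (\<alpha> $ i)) *\<^sub>R v i)
                 + 1 / 2 * P (x - (\<epsilon> * sqrt (\<alpha> $ i)) *\<^sub>R v i)))"

text \<open>\<open>c \<le> g(\<epsilon>) + o(\<epsilon>\<^sup>2)\<close> and \<open>c \<ge> g(\<epsilon>) + o(\<epsilon>\<^sup>2)\<close> as \<open>\<epsilon> \<rightarrow> 0\<close> through positive values.\<close>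

definition le_plus_o2 :: "real \<Rightarrow> (real \<Rightarrow> real) \<Rightarrow> bool" where
  "le_plus_o2 c g \<longleftrightarrow> ((\<lambda>\<epsilon>. max 0 (c - g \<epsilon>) / \<epsilon>\<^sup>2) \<longlongrightarrow> 0) (at_right 0)"

definition ge_plus_o2 :: "real \<Rightarrow> (real \<Rightarrow> real) \<Rightarrow> bool" where
  "ge_plus_o2 c g \<longleftrightarrow> ((\<lambda>\<epsilon>. max 0 (- (c - g \<epsilon>)) / \<epsilon>\<^sup>2) \<longlongrightarrow> 0) (at_right 0)"

definition expansion_holds_viscosity ::
    "(real ^ 'n) set \<Rightarrow> (real \<Rightarrow> real) \<Rightarrow> (real ^ 'n \<Rightarrow> real) \<Rightarrow> (real ^ 'n \<Rightarrow> real) \<Rightarrow> bool" where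
  "expansion_holds_viscosity \<Omega> \<phi> f u \<longleftrightarrow>
     (\<forall>x\<in>\<Omega>. \<forall>P. convex_paraboloid P \<longrightarrow>
        (touches_above \<Omega> u P x \<longrightarrow>
           le_plus_o2 (P x) (\<lambda>\<epsilon>. inf_mean \<phi> P x \<epsilon> - \<epsilon>\<^sup>2 / 2 * root CARD('n) (f x))) \<and>
        (touches_below \<Omega> u P x \<longrightarrow>
           ge_plus_o2 (P x) (\<lambda>\<epsilon>. inf_mean \<phi> P x \<epsilon> - \<epsilon>\<^sup>2 / 2 * root CARD('n) (f x))))"

definition viscosity_subsolution ::
    "(real ^ 'n) set \<Rightarrow> (real ^ 'n \<Rightarrow> real) \<Rightarrow> (real ^ 'n \<Rightarrow> real) \<Rightarrow> bool" where
  "viscosity_subsolution \<Omega> f u \<longleftrightarrow>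
     (\<forall>x\<in>\<Omega>. \<forall>P. convex_paraboloid P \<and> touches_above \<Omega> u P x \<longrightarrow> det (hessian P x) \<ge> f x)"

definition viscosity_supersolution ::
    "(real ^ 'n) set \<Rightarrow> (real ^ 'n \<Rightarrow> real) \<Rightarrow> (real ^ 'n \<Rightarrow> real) \<Rightarrow> bool" where
  "viscosity_supersolution \<Omega> f u \<longleftrightarrow>
     (\<forall>x\<in>\<Omega>. \<forall>P. convex_paraboloid P \<and> touches_below \<Omega> u P x \<longrightarrow> det (hessian P x) \<le> f x)"

definition viscosity_solution ::
    "(real ^ 'n) set \<Rightarrow> (real ^ 'n \<Rightarrow> real) \<Rightarrow> (real ^ 'n \<Rightarrow> real) \<Rightarrow> bool" where
  "viscosity_solution \<Omega> f u \<longleftrightarrow> viscosity_subsolution \<Omega> f u \<and> viscosity_supersolution \<Omega> f u"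

end

(* For a convex paraboloid P with Hessian H, the average over an orthonormal basis v with weights
   alpha is exactly P x + eps^2/2 * (1/n) * sum_i alpha_i <v_i, H v_i>. By AM-GM and Hadamard's
   inequality the last mean is at least (det H)^(1/n). Conversely, on an eigenbasis of H,
   admissible weights bring it arbitrarily close to (det H)^(1/n), and since phi tends to infinity
   any fixed alpha lies in I_eps for small eps. Hence (inf_mean P x - P x) / eps^2 tends to
   (det H)^(1/n) / 2, and each viscosity inequality of the expansion is, paraboloid by paraboloid,
   the corresponding inequality between det H and f x. *)

theory Submission
  imports Defs
begin

section \<open>Spectral theorem for self-adjoint maps\<close>

text \<open>A maximiser \<open>v\<close> of the Rayleigh quotient on the compact unit sphere of
  \<open>S\<close> is an eigenvector: otherwise a small move from \<open>v\<close> along the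
  residual \<open>g v - l *\<^sub>R v\<close>, which lies in \<open>S\<close> by invariance, would
  raise the quotient.\<close>

lemma max_rayleigh_quotient_eigenvector:
  fixes g :: "'a::euclidean_space \<Rightarrow> 'a"
  assumes lin: "linear g" and sym: "\<And>x y. g x \<bullet> y = x \<bullet> g y"
    and S: "subspace S" and inv: "g ` S \<subseteq> S" and ne: "S \<noteq> {0}"
  obtains v l where "v \<in> S" "norm v = 1" "g v = l *\<^sub>R v"
proof -
  obtain x where x: "x \<in> S" "x \<noteq> 0"
    using ne subspace_0[OF S] by blast
  have "x /\<^sub>R norm x \<in> sphere 0 1 \<inter> S"
    using x S by (auto simp: subspace_scale)
  moreover have "compact (sphere 0 1 \<inter> S)"
    using S by (intro compact_Int_closed) (auto simp: closed_subspace)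
  moreover have "continuous_on (sphere 0 1 \<inter> S) (\<lambda>x. x \<bullet> g x)"
    using lin by (intro continuous_intros linear_continuous_on) (simp add: linear_conv_bounded_linear)
  ultimately obtain v where v: "v \<in> sphere 0 1 \<inter> S"
    and max: "\<And>y. y \<in> sphere 0 1 \<inter> S \<Longrightarrow> y \<bullet> g y \<le> v \<bullet> g v"
    using continuous_attains_sup by (metis empty_iff)
  define l where "l = v \<bullet> g v"
  have vv: "v \<bullet> v = 1"
    using v by (simp add: norm_eq_1)
  have le: "y \<bullet> g y \<le> l * (y \<bullet> y)" if "y \<in> S" for y
  proof (cases "y = 0")
    case False
    then have "(y /\<^sub>R norm y) \<bullet> g (y /\<^sub>R norm y) \<le> l"
      using max[of "y /\<^sub>R norm y"] that S by (auto simp: subspace_scale l_def)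
    then show ?thesis
      using False lin
      by (simp add: linear_scale inverse_eq_divide power2_eq_square[symmetric] divide_simps
          power2_norm_eq_inner)
  qed (use lin in \<open>simp add: linear_0\<close>)
  define w where "w = g v - l *\<^sub>R v"
  have wS: "w \<in> S"
    using v inv S unfolding w_def by (auto intro!: subspace_diff subspace_scale)
  have "w = 0"
  proof (rule ccontr)
    assume "w \<noteq> 0"
    then have pos: "w \<bullet> w > 0" by simp
    define c where "c = w \<bullet> g w - l * (w \<bullet> w)"
    \<comment> \<open>The step is so short that the second-order term, with
      \<open>t * \<bar>c\<bar> \<le> w \<bullet> w\<close>, cannot cancel the first-order gain
      \<open>2 * (w \<bullet> w)\<close>; the \<open>+ 1\<close> covers
      \<open>c = 0\<close>.\<close>
    define t where "t = (w \<bullet> w) / (\<bar>c\<bar> + 1)"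
    have t: "t > 0" using pos by (simp add: t_def)
    have ww: "w \<bullet> w = w \<bullet> g v - l * (w \<bullet> v)"
      by (simp add: w_def inner_diff_left inner_diff_right)
    have gvw: "v \<bullet> g w = w \<bullet> g v"
      using sym[of v w] by (simp add: inner_commute)
    have "(v + t *\<^sub>R w) \<bullet> g (v + t *\<^sub>R w) \<le> l * ((v + t *\<^sub>R w) \<bullet> (v + t *\<^sub>R w))"
      using v wS S by (intro le) (auto intro!: subspace_add subspace_scale)
    then have "t * (2 * (w \<bullet> g v - l * (w \<bullet> v)) + t * c) \<le> 0"
      using lin unfolding c_def
      by (simp add: linear_add linear_scale inner_add_left inner_add_right gvw vv
          l_def[symmetric] inner_commute[of v w] algebra_simps)
    then have "2 * (w \<bullet> w) + t * c \<le> 0"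
      using t by (simp add: mult_le_0_iff flip: ww)
    moreover have "t * \<bar>c\<bar> \<le> w \<bullet> w"
      using pos by (simp add: t_def divide_simps mult_left_mono)
    moreover have "t * c \<ge> - (t * \<bar>c\<bar>)"
      using t by (smt (verit) mult_left_mono mult_minus_right)
    ultimately show False using pos by linarith
  qed
  then show thesis
    using that[of v l] v by (simp add: w_def)
qed

text \<open>Induction on the dimension over all invariant subspaces: once a unit eigenvector
  \<open>v\<close> is split off, its orthogonal complement \<open>T\<close> in \<open>S\<close> is
  again invariant, since \<open>v \<bullet> g y = g v \<bullet> y = l * (v \<bullet> y)\<close> by
  symmetry.\<close>

lemma selfadjoint_orthonormal_eigenbasis:
  fixes g :: "'a::euclidean_space \<Rightarrow> 'a"
  assumes lin: "linear g" and sym: "\<And>x y. g x \<bullet> y = x \<bullet> g y"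
    and "subspace S" and "g ` S \<subseteq> S"
  shows "\<exists>B. finite B \<and> card B = dim S \<and> B \<subseteq> S \<and> pairwise orthogonal B \<and>
           (\<forall>b\<in>B. norm b = 1 \<and> (\<exists>l. g b = l *\<^sub>R b))"
  using assms(3,4)
proof (induction "dim S" arbitrary: S)
  case 0
  then show ?case by (intro exI[of _ "{}"]) auto
next
  case (Suc n)
  have "S \<noteq> {0}" using Suc.hyps(2) by auto
  then obtain v l where v: "v \<in> S" "norm v = 1" "g v = l *\<^sub>R v"
    using max_rayleigh_quotient_eigenvector[OF lin sym Suc.prems] by blast
  define T where "T = {y \<in> S. v \<bullet> y = 0}"
  have T: "subspace T"
    using Suc.prems(1) unfolding T_def subspace_def by (auto simp: inner_add_right)
  have "{y \<in> S. \<forall>x\<in>span {v}. orthogonal x y} = T"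
    unfolding T_def by (auto simp: orthogonal_def span_singleton)
  moreover have "span {v} \<subseteq> S"
    using v Suc.prems(1) by (simp add: span_minimal)
  moreover have "dim {v} = 1"
    using v(2) by (simp add: dim_singleton) auto
  ultimately have "dim T + 1 = dim S"
    using dim_subspace_orthogonal_to_vectors[of "span {v}" S] Suc.prems(1) by simp
  then have "n = dim T" using Suc.hyps(2) by simp
  moreover have "g ` T \<subseteq> T"
    using Suc.prems(2) by (auto simp: T_def v(3) simp flip: sym)
  ultimately obtain B where B: "finite B" "card B = dim T" "B \<subseteq> T" "pairwise orthogonal B"
      "\<forall>b\<in>B. norm b = 1 \<and> (\<exists>l. g b = l *\<^sub>R b)"
    using Suc.hyps(1)[of T] T by blast
  have "v \<notin> B" using B(3) v(2) by (auto simp: T_def)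
  moreover have "pairwise orthogonal (insert v B)"
    using B(3,4) by (auto simp: pairwise_insert T_def orthogonal_def inner_commute)
  ultimately show ?case
    using B v \<open>dim T + 1 = dim S\<close>
    by (intro exI[of _ "insert v B"]) (auto simp: T_def)
qed

section \<open>Orthonormal bases as orthogonal matrices, and diagonalisation\<close>

lemma orthonormal_bases_orthogonal:
  assumes "(w :: 'n \<Rightarrow> real ^ 'n) \<in> orthonormal_bases"
  shows "orthogonal_matrix (\<chi> i. w i)"
proof -
  have "(\<chi> i. w i) ** transpose (\<chi> i. w i) = (mat 1 :: real ^ 'n ^ 'n)"
    using assms unfolding orthonormal_bases_def
    by (simp add: vec_eq_iff matrix_matrix_mult_def transpose_def mat_def inner_vec_def)
  then show ?thesis
    by (simp add: orthogonal_matrix_def matrix_left_right_inverse)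
qed

text \<open>The matrix \<open>W\<close> with rows \<open>w k\<close> preserves the norm. Applied to
  two orthonormal bases against each other, this will make their squared inner products doubly
  stochastic.\<close>

lemma orthonormal_bases_parseval:
  assumes "(w :: 'n \<Rightarrow> real ^ 'n) \<in> orthonormal_bases"
  shows "(\<Sum>k\<in>UNIV. (w k \<bullet> x)\<^sup>2) = x \<bullet> x"
proof -
  define W where "W = (\<chi> i. w i)"
  have "transpose W ** W = mat 1"
    using orthonormal_bases_orthogonal[OF assms] by (simp add: orthogonal_matrix W_def)
  then have "x \<bullet> x = x \<bullet> (transpose W *v (W *v x))"
    by (simp add: matrix_vector_mul_assoc)
  also have "\<dots> = (W *v x) \<bullet> (W *v x)"
    by (simp add: dot_lmul_matrix[symmetric] inner_commute)
  also have "\<dots> = (\<Sum>k\<in>UNIV. (w k \<bullet> x)\<^sup>2)"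
    unfolding inner_vec_def[of "W *v x"] by (simp add: W_def matrix_vector_mul_component power2_eq_square)
  finally show ?thesis by simp
qed

text \<open>The induction above yields a set of eigenvectors; having \<open>CARD('n)\<close>
  elements, it can be enumerated by the index type, as \<open>orthonormal_bases\<close>
  demands.\<close>

lemma symmetric_matrix_diagonalizable:
  fixes H :: "real ^ 'n ^ 'n"
  assumes "transpose H = H"
  obtains w l where "w \<in> orthonormal_bases" "\<And>k. H *v w k = l k *\<^sub>R w k"
proof -
  have sym: "(H *v x) \<bullet> y = x \<bullet> (H *v y)" for x y
    by (metis assms dot_lmul_matrix transpose_matrix_vector)
  obtain B where B: "finite B" "card B = dim (UNIV :: (real ^ 'n) set)" "pairwise orthogonal B"
      "\<forall>b\<in>B. norm b = 1 \<and> (\<exists>l. H *v b = l *\<^sub>R b)"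
    using selfadjoint_orthonormal_eigenbasis[of "(*v) H" UNIV] sym by auto
  have "card B = CARD('n)" using B(2) by simp
  then obtain w where w: "bij_betw w (UNIV :: 'n set) B"
    using finite_same_card_bij[of "UNIV :: 'n set" B] B(1) by auto
  have wB: "w k \<in> B" for k using w by (auto simp: bij_betw_def)
  have "0 \<notin> B" using B(4) by force
  then have "independent B"
    using B(3) by (rule pairwise_orthogonal_independent[rotated])
  then have "span B = UNIV"
    using B(1,2) by (metis card_eq_dim top.extremum top.extremum_unique)
  moreover have "w i \<bullet> w j = (if i = j then 1 else 0)" for i j
    using B(3,4) wB w unfolding pairwise_def orthogonal_def bij_betw_def
    by (metis UNIV_I inj_on_def norm_eq_1)
  ultimately have "w \<in> orthonormal_bases"
    using w by (simp add: orthonormal_bases_def bij_betw_def)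
  moreover have "\<forall>k. \<exists>l. H *v w k = l *\<^sub>R w k"
    using B(4) wB by blast
  then obtain l where "\<And>k. H *v w k = l k *\<^sub>R w k"
    using choice[of "\<lambda>k l. H *v w k = l *\<^sub>R w k"] by blast
  ultimately show thesis by (rule that)
qed

text \<open>Conjugation by the matrix \<open>W\<close> with rows \<open>w k\<close> makes
  \<open>H\<close> diagonal and keeps the determinant, because
  \<open>det W * det (transpose W) = 1\<close>.\<close>

lemma det_eq_prod_eigenvalues:
  fixes H :: "real ^ 'n ^ 'n"
  assumes w: "w \<in> orthonormal_bases" and eig: "\<And>k. H *v w k = l k *\<^sub>R w k"
  shows "det H = (\<Prod>k\<in>UNIV. l k)"
proof -
  define W where "W = (\<chi> i. w i)"
  have W: "W ** transpose W = mat 1" "transpose W ** W = mat 1"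
    using orthonormal_bases_orthogonal[OF w] by (simp_all add: orthogonal_matrix_def W_def)
  have "(W ** (H ** transpose W)) $ i $ j = w i \<bullet> (H *v w j)" for i j
    by (simp add: W_def matrix_matrix_mult_def transpose_def inner_vec_def matrix_vector_mult_def)
  then have "(W ** (H ** transpose W)) $ i $ j = (if i = j then l i else 0)" for i j
    using w by (simp add: eig orthonormal_bases_def)
  then have "det (W ** (H ** transpose W)) = (\<Prod>k\<in>UNIV. l k)"
    by (subst det_diagonal) auto
  moreover have "det W * det (transpose W) = 1"
    by (metis W(1) det_I det_mul)
  ultimately show ?thesis
    by (simp add: det_mul mult_ac)
qed

lemma quadratic_form_eigenbasis:
  fixes H :: "real ^ 'n ^ 'n"
  assumes w: "w \<in> orthonormal_bases" and eig: "\<And>k. H *v w k = l k *\<^sub>R w k"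
  shows "x \<bullet> (H *v x) = (\<Sum>k\<in>UNIV. l k * (w k \<bullet> x)\<^sup>2)"
proof -
  define W where "W = (\<chi> i. w i)"
  have W: "transpose W ** W = mat 1"
    using orthonormal_bases_orthogonal[OF w] by (simp add: orthogonal_matrix_def W_def)
  \<comment> \<open>Read in this order, orthogonality is the expansion of \<open>x\<close> in the
    basis \<open>w\<close>, to which \<open>H\<close> is then applied term by term.\<close>
  have "x = transpose W *v (W *v x)"
    using W by (simp add: matrix_vector_mul_assoc)
  also have "\<dots> = (\<Sum>k\<in>UNIV. (w k \<bullet> x) *\<^sub>R w k)"
    by (simp add: vec_eq_iff matrix_vector_mult_def transpose_def W_def inner_vec_def mult.commute)
  finally have "H *v x = (\<Sum>k\<in>UNIV. (w k \<bullet> x) *\<^sub>R (l k *\<^sub>R w k))"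
    by (metis (mono_tags, lifting) eig linear_sum matrix_vector_mul_linear matrix_vector_mult_scaleR sum.cong)
  then show ?thesis
    by (simp add: inner_sum_right inner_commute power2_eq_square mult_ac)
qed


section \<open>The root of the determinant as an infimum of weighted means\<close>

text \<open>With an eigenbasis \<open>w\<close> and eigenvalues \<open>l\<close>, the right-hand side is the mean of the
  \<open>\<alpha>\<^sub>i l\<^sub>k\<close> with the doubly stochastic weights \<open>(w\<^sub>k \<bullet> v\<^sub>i)\<^sup>2 / n\<close>, so Hadamard's inequality
  and AM-GM are obtained in one stroke from \<open>ln t \<le> t - 1\<close>.\<close>

lemma root_det_le_weighted_mean:
  fixes H :: "real ^ 'n ^ 'n"
  assumes sym: "transpose H = H" and psd: "\<And>x. 0 \<le> x \<bullet> (H *v x)"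
    and v: "v \<in> orthonormal_bases"
    and \<alpha>: "\<And>i. 0 < \<alpha> i" "(\<Prod>i\<in>UNIV. \<alpha> i) = 1"
  shows "root CARD('n) (det H) \<le> 1 / real CARD('n) * (\<Sum>i\<in>UNIV. \<alpha> i * (v i \<bullet> (H *v v i)))"
proof -
  obtain w l where w: "w \<in> orthonormal_bases" and eig: "\<And>k. H *v w k = l k *\<^sub>R w k"
    using symmetric_matrix_diagonalizable[OF sym] by blast
  have l0: "l k \<ge> 0" for k
    using psd[of "w k"] w by (simp add: eig orthonormal_bases_def)
  have det: "det H = (\<Prod>k\<in>UNIV. l k)"
    using w eig by (rule det_eq_prod_eigenvalues)
  show ?thesis
  \<comment> \<open>Logarithms need positive eigenvalues; a zero eigenvalue makes the left-hand side
    vanish.\<close>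
  proof (cases "\<exists>k. l k = 0")
    case True
    then have "det H = 0" using det by auto
    then show ?thesis
      using \<alpha>(1) psd by (auto intro!: divide_nonneg_nonneg sum_nonneg mult_nonneg_nonneg simp: less_imp_le)
  next
    case False
    then have l: "l k > 0" for k using l0[of k] by (metis order_le_less)
    define G where "G = root CARD('n) (det H)"
    have "det H > 0" using l det by (simp add: prod_pos)
    then have G: "G > 0" by (simp add: G_def)
    have lnl: "ln (\<Prod>k\<in>UNIV. l k) = (\<Sum>k\<in>UNIV. ln (l k))"
      using l by (intro ln_prod) (auto simp: less_imp_neq[symmetric])
    have lnG: "real CARD('n) * ln G = (\<Sum>k\<in>UNIV. ln (l k))"
      using \<open>det H > 0\<close> by (simp add: G_def ln_root det lnl)
    have ln\<alpha>: "(\<Sum>i\<in>UNIV. ln (\<alpha> i)) = 0"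
      using \<alpha> ln_prod[of UNIV \<alpha>] by (metis finite ln_one order_less_irrefl)
    define p where "p i k = (w k \<bullet> v i)\<^sup>2" for i k
    have pk: "(\<Sum>k\<in>UNIV. p i k) = 1" for i
      using orthonormal_bases_parseval[OF w, of "v i"] v by (simp add: p_def orthonormal_bases_def)
    have pi: "(\<Sum>i\<in>UNIV. p i k) = 1" for k
      using orthonormal_bases_parseval[OF v, of "w k"] w
      by (simp add: p_def orthonormal_bases_def inner_commute)
    \<comment> \<open>Normalising by the geometric mean \<open>G\<close> makes the logarithms
      cancel: the \<open>ln (\<alpha> i)\<close> sum to zero, and the \<open>ln (l k)\<close> sum to
      \<open>CARD('n)\<close> times \<open>ln G\<close>.\<close>
    have ln_sum: "(\<Sum>i\<in>UNIV. \<Sum>k\<in>UNIV. p i k * (ln (\<alpha> i) + ln (l k) - ln G)) = 0"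
    proof -
      have "(\<Sum>i\<in>UNIV. \<Sum>k\<in>UNIV. p i k * ln (l k)) = (\<Sum>k\<in>UNIV. \<Sum>i\<in>UNIV. p i k * ln (l k))"
        by (rule sum.swap)
      also have "\<dots> = (\<Sum>k\<in>UNIV. ln (l k))"
        by (simp only: sum_distrib_right[symmetric] pi mult_1_left)
      finally have "(\<Sum>i\<in>UNIV. \<Sum>k\<in>UNIV. p i k * (ln (\<alpha> i) + ln (l k) - ln G)) =
          (\<Sum>i\<in>UNIV. ln (\<alpha> i)) + (\<Sum>k\<in>UNIV. ln (l k)) - (\<Sum>i\<in>(UNIV::'n set). ln G)"
        by (simp only: distrib_left right_diff_distrib sum.distrib sum_subtractf
            sum_distrib_right[symmetric] pk mult_1_left)
      then show ?thesis
        using ln\<alpha> lnG by simp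
    qed
    \<comment> \<open>The weights have total mass \<open>CARD('n)\<close>, and by
      \<open>ln_sum\<close> the logarithmic terms can be inserted without changing the
      value.\<close>
    have "G * real CARD('n) = G * (\<Sum>i\<in>(UNIV::'n set). \<Sum>k\<in>UNIV. p i k)"
      by (simp add: pk)
    also have "\<dots> = (\<Sum>i\<in>UNIV. \<Sum>k\<in>UNIV. G * (p i k * (1 + (ln (\<alpha> i) + ln (l k) - ln G))))"
      by (simp only: sum_distrib_left[symmetric] distrib_left[of "p _ _"] sum.distrib mult_1_right
          ln_sum add_0_right)
    also have "\<dots> \<le> (\<Sum>i\<in>UNIV. \<Sum>k\<in>UNIV. p i k * (\<alpha> i * l k))"
    proof (intro sum_mono)
      fix i k
      have "ln (\<alpha> i * l k / G) \<le> \<alpha> i * l k / G - 1"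
        using \<alpha>(1) l G by (intro ln_le_minus_one) simp
      moreover have "ln (\<alpha> i * l k / G) = ln (\<alpha> i) + ln (l k) - ln G"
        using \<alpha>(1)[of i] l[of k] G by (simp add: ln_mult ln_div)
      ultimately have "G * (1 + (ln (\<alpha> i) + ln (l k) - ln G)) \<le> \<alpha> i * l k"
        using G by (simp add: field_simps)
      then have "p i k * (G * (1 + (ln (\<alpha> i) + ln (l k) - ln G))) \<le> p i k * (\<alpha> i * l k)"
        by (rule mult_left_mono) (simp add: p_def)
      then show "G * (p i k * (1 + (ln (\<alpha> i) + ln (l k) - ln G))) \<le> p i k * (\<alpha> i * l k)"
        by (simp only: mult.left_commute)
    qed
    also have "\<dots> = (\<Sum>i\<in>UNIV. \<alpha> i * (v i \<bullet> (H *v v i)))"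
      by (simp add: quadratic_form_eigenbasis[OF w eig] p_def sum_distrib_left mult_ac)
    finally show ?thesis by (simp add: G_def field_simps)
  qed
qed

text \<open>Vanishing eigenvalues are shifted by a small \<open>\<delta>\<close> before equalising the products \<open>\<alpha>\<^sub>i l\<^sub>i\<close>.\<close>

lemma ex_weighted_mean_less:
  fixes H :: "real ^ 'n ^ 'n"
  assumes sym: "transpose H = H" and psd: "\<And>x. 0 \<le> x \<bullet> (H *v x)"
    and c: "root CARD('n) (det H) < c"
  obtains v \<alpha> where "v \<in> orthonormal_bases" "\<And>i. 0 < \<alpha> i" "(\<Prod>i\<in>UNIV. \<alpha> i) = 1"
    "1 / real CARD('n) * (\<Sum>i\<in>UNIV. \<alpha> i * (v i \<bullet> (H *v v i))) < c"
proof -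
  obtain w l where w: "w \<in> orthonormal_bases" and eig: "\<And>k. H *v w k = l k *\<^sub>R w k"
    using symmetric_matrix_diagonalizable[OF sym] by blast
  have wHw: "w k \<bullet> (H *v w k) = l k" for k
    using w by (simp add: eig orthonormal_bases_def)
  then have l: "l k \<ge> 0" for k using psd by metis
  have det: "det H = (\<Prod>k\<in>UNIV. l k)"
    using w eig by (rule det_eq_prod_eigenvalues)
  \<comment> \<open>The shifted root is continuous at \<open>\<delta> = 0\<close>, so the strict gap
    below \<open>c\<close> leaves room for some positive shift.\<close>
  have "((\<lambda>\<delta>. root CARD('n) (\<Prod>k\<in>UNIV. l k + \<delta>)) \<longlongrightarrow> root CARD('n) (\<Prod>k\<in>UNIV. l k + 0)) (at_right 0)"
    by (intro tendsto_intros)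
  then have "\<forall>\<^sub>F \<delta> in at_right 0. root CARD('n) (\<Prod>k\<in>UNIV. l k + \<delta>) < c"
    using c det by (intro order_tendstoD(2)) auto
  then have "\<forall>\<^sub>F \<delta> in at_right 0. root CARD('n) (\<Prod>k\<in>UNIV. l k + \<delta>) < c \<and> \<delta> > 0"
    using eventually_at_right_less by (rule eventually_conj)
  then obtain \<delta> :: real where \<delta>: "root CARD('n) (\<Prod>k\<in>UNIV. l k + \<delta>) < c" "\<delta> > 0"
    by (auto dest: eventually_happens)
  define G where "G = root CARD('n) (\<Prod>k\<in>UNIV. l k + \<delta>)"
  \<comment> \<open>All products \<open>\<alpha> i * (l i + \<delta>)\<close> equal
    \<open>G\<close>, the equality case of AM-GM; the choice of \<open>G\<close> is what makes the
    weights multiply to one.\<close>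
  define \<alpha> where "\<alpha> i = G / (l i + \<delta>)" for i
  have l\<delta>: "l i + \<delta> > 0" for i using l[of i] \<delta>(2) by simp
  then have prod: "(\<Prod>k\<in>UNIV. l k + \<delta>) > 0" by (simp add: prod_pos)
  then have G: "G > 0" by (simp add: G_def)
  have "\<alpha> i > 0" for i using G l\<delta> by (simp add: \<alpha>_def)
  moreover have "(\<Prod>i\<in>UNIV. \<alpha> i) = 1"
  proof -
    have "(\<Prod>i\<in>UNIV. \<alpha> i) = G ^ CARD('n) / (\<Prod>k\<in>UNIV. l k + \<delta>)"
      by (simp add: \<alpha>_def prod_dividef)
    also have "\<dots> = 1"
      unfolding G_def real_root_pow_pos[OF zero_less_card_finite prod]
      using prod by (rule divide_self[OF less_imp_neq[symmetric]])
    finally show ?thesis .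
  qed
  moreover have "1 / real CARD('n) * (\<Sum>i\<in>UNIV. \<alpha> i * (w i \<bullet> (H *v w i))) < c"
  proof -
    have "\<alpha> i * l i \<le> G" for i
      using G l\<delta>[of i] \<delta>(2) by (simp add: \<alpha>_def field_simps)
    then have "(\<Sum>i\<in>UNIV. \<alpha> i * l i) \<le> real CARD('n) * G"
      by (intro sum_bounded_above) simp
    also have "\<dots> < real CARD('n) * c"
      using \<delta>(1) unfolding G_def by (rule mult_strict_left_mono) simp
    finally show ?thesis
      by (simp add: wHw divide_simps mult.commute)
  qed
  ultimately show thesis using that w by blast
qed

section \<open>Hessian and second differences of a convex paraboloid\<close>

text \<open>Since \<open>A\<close> need not be symmetric, differentiating the bilinear form in each
  of its two slots gives \<open>A\<close> and its transpose rather than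
  \<open>2 * A\<close>.\<close>

lemma hessian_quadratic:
  fixes A :: "real ^ 'n ^ 'n"
  assumes P: "\<And>x. P x = x \<bullet> (A *v x) + b \<bullet> x + c"
  shows "hessian P x = A + transpose A"
proof -
  have P': "P = (\<lambda>x. x \<bullet> (A *v x) + b \<bullet> x + c)" using P by auto
  have bl: "bounded_linear ((*v) A)" by simp
  have "(P has_derivative (\<lambda>h. y \<bullet> (A *v h) + h \<bullet> (A *v y) + b \<bullet> h)) (at y)" for y
    unfolding P' by (auto intro!: derivative_eq_intros bounded_linear.has_derivative[OF bl])
  then have "frechet_derivative P (at y) = (\<lambda>h. y \<bullet> (A *v h) + h \<bullet> (A *v y) + b \<bullet> h)" for y
    by (rule frechet_derivative_at[symmetric])
  moreover have "((\<lambda>y. y \<bullet> (A *v k) + k \<bullet> (A *v y) + b \<bullet> k) has_derivative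
      (\<lambda>h. h \<bullet> (A *v k) + k \<bullet> (A *v h))) (at x)" for k
    by (auto intro!: derivative_eq_intros bounded_linear.has_derivative[OF bl])
  then have "frechet_derivative (\<lambda>y. y \<bullet> (A *v k) + k \<bullet> (A *v y) + b \<bullet> k) (at x) =
      (\<lambda>h. h \<bullet> (A *v k) + k \<bullet> (A *v h))" for k
    by (rule frechet_derivative_at[symmetric])
  ultimately have "hessian P x = (\<chi> i j. axis i 1 \<bullet> (A *v axis j 1) + axis j 1 \<bullet> (A *v axis i 1))"
    by (simp only: hessian_def)
  then show ?thesis
    by (simp add: vec_eq_iff inner_axis' transpose_def matrix_vector_mult_basis column_def)
qed

text \<open>The symmetric second difference cancels the linear part and is exact for a quadratic.
  Convexity at the midpoint \<open>x\<close> of \<open>x + h\<close> and \<open>x - h\<close> makes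
  it non-negative, whence semidefiniteness.\<close>

lemma convex_paraboloid_hessian:
  fixes P :: "real ^ 'n \<Rightarrow> real"
  assumes "convex_paraboloid P"
  shows "transpose (hessian P x) = hessian P x"
    and "0 \<le> h \<bullet> (hessian P x *v h)"
    and "1 / 2 * P (x + h) + 1 / 2 * P (x - h) = P x + 1 / 2 * (h \<bullet> (hessian P x *v h))"
proof -
  obtain A :: "real ^ 'n ^ 'n" and b c where P: "\<And>x. P x = x \<bullet> (A *v x) + b \<bullet> x + c"
    using assms unfolding convex_paraboloid_def paraboloid_def by blast
  have H: "hessian P x = A + transpose A" using P by (rule hessian_quadratic)
  show "transpose (hessian P x) = hessian P x"
    by (simp add: H vec_eq_iff transpose_def)
  have "h \<bullet> (transpose A *v h) = h \<bullet> (A *v h)"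
    by (metis dot_lmul_matrix inner_commute transpose_matrix_vector)
  then have Hh: "h \<bullet> (hessian P x *v h) = 2 * (h \<bullet> (A *v h))"
    by (simp add: H matrix_vector_mult_add_rdistrib inner_add_right)
  show mean: "1 / 2 * P (x + h) + 1 / 2 * P (x - h) = P x + 1 / 2 * (h \<bullet> (hessian P x *v h))"
    by (simp add: Hh P matrix_vector_right_distrib matrix_vector_mult_diff_distrib
        inner_add_left inner_add_right inner_diff_left inner_diff_right field_simps)
  have "P ((1 - 1/2) *\<^sub>R (x + h) + (1/2) *\<^sub>R (x - h)) \<le> (1 - 1/2) * P (x + h) + (1/2) * P (x - h)"
    using assms unfolding convex_paraboloid_def by (intro convex_onD[of UNIV P]) auto
  moreover have "(1 - 1/2) *\<^sub>R (x + h) + (1/2) *\<^sub>R (x - h) = x"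
    by (simp add: algebra_simps flip: scaleR_add_left)
  ultimately show "0 \<le> h \<bullet> (hessian P x *v h)"
    using mean by simp
qed

section \<open>Second-order limit of the infimum of means\<close>

text \<open>The lower bound holds at every \<open>\<epsilon>\<close> with
  \<open>\<phi> \<epsilon> > 1\<close>; the upper bound tests a single near-optimal pair of basis
  and weights, fixed before \<open>\<epsilon>\<close> tends to zero.\<close>

lemma inf_mean_tendsto:
  fixes P :: "real ^ 'n \<Rightarrow> real"
  assumes P: "convex_paraboloid P" and \<phi>: "filterlim \<phi> at_top (at_right 0)"
  shows "((\<lambda>\<epsilon>. (inf_mean \<phi> P x \<epsilon> - P x) / \<epsilon>\<^sup>2) \<longlongrightarrow> root CARD('n) (det (hessian P x)) / 2) (at_right 0)"
proof -
  define H where "H = hessian P x"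
  define D where "D = root CARD('n) (det H)"
  define M where "M \<epsilon> v \<alpha> = 1 / real CARD('n) *
        (\<Sum>i\<in>UNIV. 1 / 2 * P (x + (\<epsilon> * sqrt (\<alpha> $ i)) *\<^sub>R v i)
                 + 1 / 2 * P (x - (\<epsilon> * sqrt (\<alpha> $ i)) *\<^sub>R v i))" for \<epsilon> :: real and v and \<alpha> :: "real ^ 'n"
  note H = convex_paraboloid_hessian[OF P, where x = x, folded H_def]
  have M: "M \<epsilon> v \<alpha> = P x + \<epsilon>\<^sup>2 / 2 * (1 / real CARD('n) * (\<Sum>i\<in>UNIV. \<alpha> $ i * (v i \<bullet> (H *v v i))))"
    if "\<And>i. 0 < \<alpha> $ i" for \<epsilon> v \<alpha>
  proof -
    have "1 / 2 * P (x + (\<epsilon> * sqrt (\<alpha> $ i)) *\<^sub>R v i) + 1 / 2 * P (x - (\<epsilon> * sqrt (\<alpha> $ i)) *\<^sub>R v i)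
        = P x + \<epsilon>\<^sup>2 / 2 * (\<alpha> $ i * (v i \<bullet> (H *v v i)))" for i
    proof -
      have "(\<epsilon> * sqrt (\<alpha> $ i)) * (\<epsilon> * sqrt (\<alpha> $ i)) = \<epsilon>\<^sup>2 * \<alpha> $ i"
        using that[of i] by (simp add: power2_eq_square)
      then show ?thesis
        unfolding H(3) by (simp add: matrix_vector_mult_scaleR flip: mult.assoc)
    qed
    then show ?thesis
      unfolding M_def by (simp only: sum.distrib distrib_left sum_distrib_left[symmetric]) simp
  qed
  have lower: "P x + \<epsilon>\<^sup>2 / 2 * D \<le> M \<epsilon> v \<alpha>"
    if "v \<in> orthonormal_bases" "\<alpha> \<in> I_set \<phi> \<epsilon>" for \<epsilon> v \<alpha>
  proof -
    have \<alpha>: "\<And>i. 0 < \<alpha> $ i" "(\<Prod>i\<in>UNIV. \<alpha> $ i) = 1"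
      using that(2) by (auto simp: I_set_def)
    show ?thesis
      unfolding M[OF \<alpha>(1)] D_def
      by (intro add_left_mono mult_left_mono root_det_le_weighted_mean H(1,2) that(1) \<alpha>) simp
  qed
  have inf: "inf_mean \<phi> P x \<epsilon> = (INF v\<in>orthonormal_bases. INF \<alpha>\<in>I_set \<phi> \<epsilon>. M \<epsilon> v \<alpha>)" for \<epsilon>
    by (simp add: inf_mean_def M_def)
  obtain w :: "'n \<Rightarrow> real ^ 'n" where w: "w \<in> orthonormal_bases"
    using symmetric_matrix_diagonalizable[OF H(1)] by blast
  \<comment> \<open>The all-ones weights show that the inner infimum is over a nonempty set.\<close>
  have I: "(1 :: real ^ 'n) \<in> I_set \<phi> \<epsilon>" if "\<phi> \<epsilon> > 1" for \<epsilon>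
    using that by (simp add: I_set_def one_less_power)
  have inner_lower: "P x + \<epsilon>\<^sup>2 / 2 * D \<le> (INF \<alpha>\<in>I_set \<phi> \<epsilon>. M \<epsilon> v \<alpha>)"
    if "\<phi> \<epsilon> > 1" "v \<in> orthonormal_bases" for \<epsilon> v
    using I[OF that(1)] by (intro cINF_greatest lower[OF that(2)]) auto
  have ge: "P x + \<epsilon>\<^sup>2 / 2 * D \<le> inf_mean \<phi> P x \<epsilon>" if "\<phi> \<epsilon> > 1" for \<epsilon>
    unfolding inf using w by (intro cINF_greatest inner_lower[OF that]) auto
  \<comment> \<open>A real infimum is known to lie below its members only if the family is bounded
    below; \<open>inner_lower\<close> and \<open>lower\<close> bound the outer and the inner
    family.\<close>
  have le: "inf_mean \<phi> P x \<epsilon> \<le> M \<epsilon> v \<alpha>"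
    if "\<phi> \<epsilon> > 1" "v \<in> orthonormal_bases" "\<alpha> \<in> I_set \<phi> \<epsilon>" for \<epsilon> v \<alpha>
  proof -
    have "inf_mean \<phi> P x \<epsilon> \<le> (INF \<alpha>\<in>I_set \<phi> \<epsilon>. M \<epsilon> v \<alpha>)"
      unfolding inf by (rule cINF_lower[OF bdd_belowI2[OF inner_lower[OF that(1)]] that(2)])
    also have "\<dots> \<le> M \<epsilon> v \<alpha>"
      by (rule cINF_lower[OF bdd_belowI2[OF lower[OF that(2)]] that(3)])
    finally show ?thesis .
  qed
  have large: "\<forall>\<^sub>F \<epsilon> in at_right 0. C < \<phi> \<epsilon>" for C
    using \<phi> by (simp add: filterlim_at_top_dense)
  show ?thesis
    unfolding H_def[symmetric] D_def[symmetric]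
  proof (rule order_tendstoI)
    fix a assume "a < D / 2"
    show "\<forall>\<^sub>F \<epsilon> in at_right 0. a < (inf_mean \<phi> P x \<epsilon> - P x) / \<epsilon>\<^sup>2"
      using large[of 1] eventually_at_right_less[of 0]
    proof eventually_elim
      case (elim \<epsilon>)
      then have "D / 2 \<le> (inf_mean \<phi> P x \<epsilon> - P x) / \<epsilon>\<^sup>2"
        using ge[of \<epsilon>] by (simp add: field_simps)
      with \<open>a < D / 2\<close> show ?case by (rule less_le_trans)
    qed
  next
    fix a assume "D / 2 < a"
    then have "root CARD('n) (det H) < 2 * a" by (simp add: D_def)
    then obtain v \<alpha> where v: "v \<in> orthonormal_bases" and \<alpha>: "\<And>i. 0 < \<alpha> i" "(\<Prod>i\<in>UNIV. \<alpha> i) = 1"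
      and less: "1 / real CARD('n) * (\<Sum>i\<in>UNIV. \<alpha> i * (v i \<bullet> (H *v v i))) < 2 * a"
      using ex_weighted_mean_less[OF H(1,2)] by blast
    define \<beta> where "\<beta> = (\<chi> i. \<alpha> i)"
    \<comment> \<open>There are finitely many indices, so one threshold serves all weights; with
      \<open>\<phi> \<epsilon> > 1\<close> these bounds can be squared.\<close>
    have "\<forall>\<^sub>F \<epsilon> in at_right 0. \<forall>i. sqrt (\<alpha> i) < \<phi> \<epsilon>"
      using large by (simp add: eventually_all_finite)
    then show "\<forall>\<^sub>F \<epsilon> in at_right 0. (inf_mean \<phi> P x \<epsilon> - P x) / \<epsilon>\<^sup>2 < a"
      using large[of 1] eventually_at_right_less[of 0]
    proof eventually_elim
      case (elim \<epsilon>)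
      have "\<alpha> i < (\<phi> \<epsilon>)\<^sup>2" for i
        using elim(1)[rule_format, of i] elim(2) real_sqrt_less_iff[of "\<alpha> i" "(\<phi> \<epsilon>)\<^sup>2"] by simp
      then have "\<beta> \<in> I_set \<phi> \<epsilon>" using \<alpha> by (simp add: I_set_def \<beta>_def)
      then have "inf_mean \<phi> P x \<epsilon> \<le> M \<epsilon> v \<beta>" using le[of \<epsilon> v \<beta>] v elim(2) by simp
      also have "\<dots> < P x + \<epsilon>\<^sup>2 / 2 * (2 * a)"
        using mult_strict_left_mono[OF less, of "\<epsilon>\<^sup>2 / 2"] \<alpha>(1) elim(3)
        by (subst M) (auto simp: \<beta>_def)
      finally show ?case using elim(3) by (simp add: field_simps)
    qed
  qed
qed

section \<open>From the limit to the one-sided expansions\<close>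

lemma tendsto_max_0_iff:
  fixes d :: real
  assumes "(g \<longlongrightarrow> d) F" and F: "F \<noteq> bot"
  shows "((\<lambda>x. max 0 (g x)) \<longlongrightarrow> 0) F \<longleftrightarrow> d \<le> 0"
proof -
  have lim: "((\<lambda>x. max 0 (g x)) \<longlongrightarrow> max 0 d) F"
    using assms(1) by (intro tendsto_intros)
  then have "((\<lambda>x. max 0 (g x)) \<longlongrightarrow> 0) F \<longleftrightarrow> max 0 d = 0"
    using tendsto_unique[OF F] by metis
  then show ?thesis by (simp add: max_def)
qed

text \<open>After division by \<open>\<epsilon>\<^sup>2\<close> the error is
  \<open>r / 2 - ?q \<epsilon>\<close> or its negative, which converges; its positive part tends to
  zero exactly when its limit is at most zero.\<close>

lemma le_ge_plus_o2_iff: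
  fixes c d r :: real
  assumes "((\<lambda>\<epsilon>. (m \<epsilon> - c) / \<epsilon>\<^sup>2) \<longlongrightarrow> d / 2) (at_right 0)"
  shows "le_plus_o2 c (\<lambda>\<epsilon>. m \<epsilon> - \<epsilon>\<^sup>2 / 2 * r) \<longleftrightarrow> r \<le> d"
    and "ge_plus_o2 c (\<lambda>\<epsilon>. m \<epsilon> - \<epsilon>\<^sup>2 / 2 * r) \<longleftrightarrow> d \<le> r"
proof -
  let ?q = "\<lambda>\<epsilon>. (m \<epsilon> - c) / \<epsilon>\<^sup>2"
  \<comment> \<open>This includes \<open>\<epsilon> = 0\<close>, where division by zero makes both
    sides zero.\<close>
  have max_divide: "max 0 y / \<epsilon>\<^sup>2 = max 0 (y / \<epsilon>\<^sup>2)" for y \<epsilon> :: real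
    by (simp add: max_def zero_le_divide_iff)
  have nz: "\<forall>\<^sub>F \<epsilon>::real in at_right 0. \<epsilon> > 0" by (rule eventually_at_right_less)
  have "le_plus_o2 c (\<lambda>\<epsilon>. m \<epsilon> - \<epsilon>\<^sup>2 / 2 * r) \<longleftrightarrow> ((\<lambda>\<epsilon>. max 0 (r / 2 - ?q \<epsilon>)) \<longlongrightarrow> 0) (at_right 0)"
    unfolding le_plus_o2_def max_divide
    by (intro tendsto_cong eventually_mono[OF nz]) (simp add: field_simps)
  also have "\<dots> \<longleftrightarrow> r / 2 - d / 2 \<le> 0"
    by (intro tendsto_max_0_iff tendsto_intros assms trivial_limit_at_right_real)
  finally show "le_plus_o2 c (\<lambda>\<epsilon>. m \<epsilon> - \<epsilon>\<^sup>2 / 2 * r) \<longleftrightarrow> r \<le> d" by simp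
  have "ge_plus_o2 c (\<lambda>\<epsilon>. m \<epsilon> - \<epsilon>\<^sup>2 / 2 * r) \<longleftrightarrow> ((\<lambda>\<epsilon>. max 0 (?q \<epsilon> - r / 2)) \<longlongrightarrow> 0) (at_right 0)"
    unfolding ge_plus_o2_def max_divide
    by (intro tendsto_cong eventually_mono[OF nz]) (simp add: diff_divide_distrib add_divide_distrib)
  also have "\<dots> \<longleftrightarrow> d / 2 - r / 2 \<le> 0"
    by (intro tendsto_max_0_iff tendsto_intros assms trivial_limit_at_right_real)
  finally show "ge_plus_o2 c (\<lambda>\<epsilon>. m \<epsilon> - \<epsilon>\<^sup>2 / 2 * r) \<longleftrightarrow> d \<le> r" by simp
qed

theorem theorem1p8:
  fixes \<Omega> :: "(real ^ 'n) set"
    and u f :: "real ^ 'n \<Rightarrow> real"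
    and \<phi> :: "real \<Rightarrow> real"
  assumes "open \<Omega>" and "convex \<Omega>" and "\<Omega> \<noteq> {}"
    and "convex_on \<Omega> u"
    and "continuous_on \<Omega> f" and "\<And>x. x \<in> \<Omega> \<Longrightarrow> f x \<ge> 0"
    and "\<And>\<epsilon>. \<epsilon> > 0 \<Longrightarrow> \<phi> \<epsilon> > 0"
    and "filterlim \<phi> at_top (at_right 0)"
    and "((\<lambda>\<epsilon>. \<epsilon> * \<phi> \<epsilon>) \<longlongrightarrow> 0) (at_right 0)"
  shows "expansion_holds_viscosity \<Omega> \<phi> f u \<longleftrightarrow> viscosity_solution \<Omega> f u"
proof -
  \<comment> \<open>Strict monotonicity of the root removes it from both sides. The equivalences
    hold for each convex paraboloid and point, before touching is considered.\<close>
  have "le_plus_o2 (P x) (\<lambda>\<epsilon>. inf_mean \<phi> P x \<epsilon> - \<epsilon>\<^sup>2 / 2 * root CARD('n) (f x)) \<longleftrightarrow> f x \<le> det (hessian P x)"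
       "ge_plus_o2 (P x) (\<lambda>\<epsilon>. inf_mean \<phi> P x \<epsilon> - \<epsilon>\<^sup>2 / 2 * root CARD('n) (f x)) \<longleftrightarrow> det (hessian P x) \<le> f x"
    if "convex_paraboloid P" for P x
    using le_ge_plus_o2_iff[OF inf_mean_tendsto[OF that assms(8), of x]] by simp_all
  then show ?thesis
    unfolding expansion_holds_viscosity_def viscosity_solution_def viscosity_subsolution_def
      viscosity_supersolution_def
    by blast
qed

end
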